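(* Let $p\ge0$ and $\nu\ge0$ (with $\nu=0$ if $p=0$), let $z\in\mathbb{C}\setminus\{0\}$, and let $\kappa,\mu\in\mathbb{C}$ with $2\mu\notin\{-1,-2,\ldots\}$ and $\mu\pm\kappa+\frac12\notin\{0,-1,-2,\ldots\}$. Then $$z^{-\mu-\frac12}M_{\kappa,\mu}^{(p,\nu)}(z)=(-z)^{-\mu-\frac12}M_{-\kappa,\mu}^{(p,\nu)}(-z).$$
   Context: $B(x,y)=\Gamma(x)\Gamma(y)/\Gamma(x+y)$ is the Beta function ($x,y\ne 0,-1,-2,\ldots$), and $K_\lambda$ is the modified Bessel function of the second kind. Complex powers of a nonzero complex number are principal (argument in $(-\pi,\pi]$), both for $z$ and for $-z$. For $\Re(p)>0$, $\nu\ge 0$, the extended Beta function is $$B_{p,\nu}(x,y)=\sqrt{\frac{2p}{\pi}}\int_0^1 t^{x-\frac32}(1-t)^{y-\frac32}K_{\nu+\frac12}\left(\frac{p}{t(1-t)}\right)dt.$$ The $(p,\nu)$-extended confluent hypergeometric function is $$\Phi_{p,\nu}(b;c;z)=\sum_{m=0}^\infty\frac{B_{p,\nu}(b+m,c-b)}{B(b,c-b)}\frac{z^m}{m!}=\frac{1}{B(b,c-b)}\sqrt{\frac{2p}{\pi}}\int_0^1t^{b-\frac32}(1-t)^{c-b-\frac32}e^{zt}K_{\nu+\frac12}\left(\frac{p}{t(1-t)}\right)dt,$$ and for $p=\nu=0$ it is the ordinary confluent hypergeometric function $\Phi_{0,0}(b;c;z)=\sum_{m\ge0}\frac{\Gamma(b+m)\Gamma(c)}{\Gamma(b)\Gamma(c+m)}\frac{z^m}{m!}$.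 The $(p,\nu)$-extended Whittaker function is $$M_{\kappa,\mu}^{(p,\nu)}(z)=z^{\mu+\frac12}e^{-z/2}\,\Phi_{p,\nu}(\mu-\kappa+\tfrac12;2\mu+1;z).$$ *)

theory Defs
  imports "HOL-Analysis.Analysis"
begin

text \<open>
  The modified Bessel function of the second kind (Macdonald function) of order \<open>\<alpha>\<close>, by its
  standard integral \<open>K\<^sub>\<alpha>(w) = \<integral>\<^sub>0\<^sup>\<infinity> exp (- w cosh u) cosh (\<alpha> u) du\<close>. The integral converges
  absolutely for \<open>Re w > 0\<close>, the only region where the function is used; it covers integer and
  non-integer orders alike. Outside that region the value has no meaning.
\<close>

definition Bessel_K :: "complex \<Rightarrow> complex \<Rightarrow> complex" where
  "Bessel_K \<alpha> w =
     (LINT u:{0<..}|lborel. exp (- w * of_real (cosh u)) * cosh (\<alpha> * of_real u))"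

text \<open>Meaningful for \<open>Re p > 0\<close> and \<open>\<nu> \<ge> 0\<close>, in which case the integral converges absolutely for
  all \<open>x\<close>, \<open>y\<close>.\<close>

definition ext_Beta :: "complex \<Rightarrow> real \<Rightarrow> complex \<Rightarrow> complex \<Rightarrow> complex" where
  "ext_Beta p \<nu> x y =
     csqrt (2 * p / of_real pi) *
     (LINT t:{0<..<1}|lborel.
        of_real t powr (x - 3 / 2) * of_real (1 - t) powr (y - 3 / 2) *
        Bessel_K (of_real (\<nu> + 1 / 2)) (p / of_real (t * (1 - t))))"

text \<open>The ordinary confluent hypergeometric function, for \<open>b\<close> and \<open>c\<close> not in \<open>{0, -1, -2, \<dots>}\<close>
  (in the library \<open>Gamma\<close> is \<open>0\<close> at its poles).\<close>

definition confluent_hyp :: "complex \<Rightarrow> complex \<Rightarrow> complex \<Rightarrow> complex" where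
  "confluent_hyp b c z =
     (\<Sum>m. Gamma (b + of_nat m) * Gamma c / (Gamma b * Gamma (c + of_nat m)) * z ^ m / fact m)"

text \<open>Meaningful for \<open>Re p > 0\<close>, \<open>\<nu> \<ge> 0\<close>, and for \<open>p = 0\<close>, \<open>\<nu> = 0\<close>.\<close>

definition ext_confluent_hyp ::
    "complex \<Rightarrow> real \<Rightarrow> complex \<Rightarrow> complex \<Rightarrow> complex \<Rightarrow> complex" where
  "ext_confluent_hyp p \<nu> b c z =
     (if p = 0 \<and> \<nu> = 0 then confluent_hyp b c z
      else (\<Sum>m. ext_Beta p \<nu> (b + of_nat m) (c - b) / Beta b (c - b) * z ^ m / fact m))"

definition ext_Whittaker_M ::
    "complex \<Rightarrow> real \<Rightarrow> complex \<Rightarrow> complex \<Rightarrow> complex \<Rightarrow> complex" where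
  "ext_Whittaker_M p \<nu> \<kappa> \<mu> z =
     z powr (\<mu> + 1 / 2) * exp (- z / 2) *
     ext_confluent_hyp p \<nu> (\<mu> - \<kappa> + 1 / 2) (2 * \<mu> + 1) z"

end

theory Submission
  imports Defs "HOL-Probability.Sinc_Integral"
begin

text \<open>
  Writing \<open>b = \<mu> - \<kappa> + 1/2\<close> and \<open>c = 2\<mu> + 1\<close>, replacing \<open>\<kappa>\<close> by \<open>-\<kappa>\<close> replaces \<open>b\<close> by \<open>c - b\<close>, and
  the powers of \<open>z\<close> and of \<open>-z\<close> cancel separately, so the claim is Kummer's transformation
  \<open>\<Phi>(b;c;z) = e\<^sup>z \<Phi>(c-b;c;-z)\<close>. For \<open>p = 0\<close> it is the Cauchy product of the two series on the right,
  evaluated by the Chu--Vandermonde identity. For \<open>p > 0\<close> the exponential decay of the Bessel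
  function makes the kernel of the extended Beta function bounded on \<open>(0,1)\<close> for all parameters,
  so the series can be summed under the integral, and the substitution of \<open>1 - t\<close> for \<open>t\<close> in the
  resulting integral of \<open>e\<^bsup>zt\<^esup>\<close> against the kernel gives the claim.
\<close>

section \<open>Decay and measurability of the Bessel function\<close>

lemma power_mult_exp_minus_le:
  fixes a y :: real
  assumes "a > 0" and "y \<ge> 0"
  shows "y ^ n * exp (- (a * y)) \<le> fact n / a ^ n"
proof -
  have s: "(\<lambda>k. (a * y) ^ k / fact k) sums exp (a * y)"
    using exp_converges[of "a * y"] by (simp add: divide_inverse mult.commute)
  \<comment> \<open>A single term of the exponential series with nonnegative terms is at most the
    sum.\<close>
  have "(\<Sum>k\<in>{n}. (a * y) ^ k / fact k) \<le> exp (a * y)"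
    unfolding sums_unique[OF s]
    by (rule sum_le_suminf[OF sums_summable[OF s]]) (use assms in auto)
  then show ?thesis
    using assms by (simp add: exp_minus field_simps power_mult_distrib)
qed

lemma cosh_complex_of_real: "cosh (complex_of_real x) = of_real (cosh x)"
  by (simp add: cosh_def exp_of_real [symmetric] scaleR_conv_of_real)

text \<open>As \<open>cosh u\<close> is at least \<open>exp u / 2\<close>, the first factor decays
  doubly exponentially and absorbs the growth of \<open>cosh (a * u)\<close>.\<close>

lemma set_integrable_exp_cosh:
  fixes a w :: real
  assumes "w > 0"
  shows "set_integrable lborel {0<..} (\<lambda>u. exp (- (w * cosh u)) * cosh (a * u))"
proof -
  \<comment> \<open>The extra 1 leaves a spare factor \<open>exp (- u)\<close>, which serves as the
    integrable majorant; \<open>C\<close> bounds the rest by \<open>power_mult_exp_minus_le\<close>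
    at \<open>exp u\<close>.\<close>
  obtain N :: nat where N: "\<bar>a\<bar> + 1 \<le> real N"
    using real_arch_simple by blast
  define C where "C = fact N / (w / 2) ^ N"
  have bound: "norm (exp (- (w * cosh u)) * cosh (a * u)) \<le> norm (C * exp (- (u * 1)))"
    if u: "u > 0" for u
  proof -
    have "\<bar>a * u\<bar> = \<bar>a\<bar> * u"
      using u by (simp add: abs_mult)
    also have "\<dots> \<le> (real N - 1) * u"
      using u N by (intro mult_right_mono) auto
    finally have *: "\<bar>a * u\<bar> \<le> real N * u - u"
      by (simp add: algebra_simps)
    have "cosh (a * u) \<le> exp (real N * u - u)"
    proof -
      have "exp (a * u) \<le> exp (real N * u - u)" "exp (- (a * u)) \<le> exp (real N * u - u)"
        using * by auto
      then have "exp (a * u) + exp (- (a * u)) \<le> 2 * exp (real N * u - u)"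
        by (simp only: mult_2 add_mono)
      then show ?thesis
        unfolding cosh_def by simp
    qed
    also have "\<dots> = exp u ^ N * exp (- u)"
      by (simp add: exp_diff exp_of_nat_mult exp_minus divide_inverse)
    finally have 1: "cosh (a * u) \<le> exp u ^ N * exp (- u)" .
    have 2: "exp (- (w * cosh u)) \<le> exp (- (w / 2 * exp u))"
      using assms by (simp add: cosh_def field_simps)
    have "exp (- (w * cosh u)) * cosh (a * u) \<le>
        exp (- (w / 2 * exp u)) * (exp u ^ N * exp (- u))"
      by (intro mult_mono 1 2) (auto simp: cosh_real_nonneg)
    also have "\<dots> = (exp u ^ N * exp (- (w / 2 * exp u))) * exp (- u)"
      by simp
    also have "\<dots> \<le> C * exp (- u)"
      unfolding C_def using assms by (intro mult_right_mono power_mult_exp_minus_le) auto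
    finally show ?thesis
      using assms by (simp add: abs_mult C_def cosh_real_nonneg)
  qed
  have "set_integrable lborel {0<..} (\<lambda>u::real. C * exp (- (u * 1)))"
    by (intro set_integrable_mult_right integrable_I0i_exp_mscale) simp
  then show ?thesis
    by (rule set_integrable_bound)
      (use bound in \<open>auto simp: set_borel_measurable_def cosh_def\<close>)
qed

text \<open>Since \<open>cosh u\<close> is at least 1, a factor \<open>exp (w0 - w)\<close> comes
  out of the integral. What remains does not depend on \<open>w\<close>, so with \<open>w0\<close>
  fixed this is exponential decay in \<open>w\<close>.\<close>

lemma norm_Bessel_K_le:
  fixes a w w0 :: real
  assumes "w0 > 0" and "w0 \<le> w"
  shows "norm (Bessel_K (of_real a) (of_real w)) \<le>
    exp (w0 - w) * (LINT u:{0<..}|lborel. exp (- (w0 * cosh u)) * cosh (a * u))"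
proof -
  have eq: "exp (- of_real w * of_real (cosh u)) * cosh (of_real a * of_real u) =
      complex_of_real (exp (- (w * cosh u)) * cosh (a * u))" for u
    by (simp flip: exp_of_real cosh_complex_of_real)
  have int: "set_integrable lborel {0<..} (\<lambda>u. exp (- (w' * cosh u)) * cosh (a * u))"
    if "w' > 0" for w' :: real
    using that by (rule set_integrable_exp_cosh)
  have le: "exp (- (w * cosh u)) * cosh (a * u) \<le>
      exp (w0 - w) * (exp (- (w0 * cosh u)) * cosh (a * u))" for u
  proof -
    have "(w - w0) * 1 \<le> (w - w0) * cosh u"
      using assms cosh_real_ge_1 by (intro mult_left_mono) auto
    then have "exp (- (w * cosh u)) \<le> exp (w0 - w) * exp (- (w0 * cosh u))"
      by (simp add: algebra_simps flip: exp_add)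
    then show ?thesis
      using mult_right_mono[OF _ cosh_real_nonneg[of "a * u"]] by (simp add: mult.assoc)
  qed
  have "Bessel_K (of_real a) (of_real w) =
      of_real (LINT u:{0<..}|lborel. exp (- (w * cosh u)) * cosh (a * u))"
    unfolding Bessel_K_def eq by (rule set_integral_complex_of_real)
  then have "norm (Bessel_K (of_real a) (of_real w)) =
      \<bar>LINT u:{0<..}|lborel. exp (- (w * cosh u)) * cosh (a * u)\<bar>"
    by simp
  also have "\<dots> = (LINT u:{0<..}|lborel. exp (- (w * cosh u)) * cosh (a * u))"
    unfolding set_lebesgue_integral_def
    by (intro abs_of_nonneg Bochner_Integration.integral_nonneg) (auto simp: cosh_real_nonneg)
  also have "\<dots> \<le>
      (LINT u:{0<..}|lborel. exp (w0 - w) * (exp (- (w0 * cosh u)) * cosh (a * u)))"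
    using assms le by (intro set_integral_mono set_integrable_mult_right int) auto
  finally show ?thesis
    by simp
qed

lemma borel_measurable_Bessel_K [measurable (raw)]:
  assumes [measurable]: "f \<in> borel_measurable M"
  shows "(\<lambda>t. Bessel_K a (f t)) \<in> borel_measurable M"
proof -
  have [measurable]: "(\<lambda>u. cosh (a * complex_of_real u)) \<in> borel_measurable borel"
    "(cosh :: real \<Rightarrow> real) \<in> borel_measurable borel"
    by (auto intro!: borel_measurable_continuous_onI continuous_intros)
  show ?thesis
    unfolding Bessel_K_def set_lebesgue_integral_def by measurable
qed

section \<open>The kernel of the extended Beta function\<close>

definition ext_Beta_kernel :: "complex \<Rightarrow> real \<Rightarrow> complex \<Rightarrow> complex \<Rightarrow> real \<Rightarrow> complex" where
  "ext_Beta_kernel p \<nu> x y t =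
     of_real t powr (x - 3 / 2) * of_real (1 - t) powr (y - 3 / 2) *
     Bessel_K (of_real (\<nu> + 1 / 2)) (p / of_real (t * (1 - t)))"

lemma ext_Beta_kernel_reflect: "ext_Beta_kernel p \<nu> x y (1 - t) = ext_Beta_kernel p \<nu> y x t"
  by (simp add: ext_Beta_kernel_def mult_ac)

lemma ext_Beta_kernel_add_of_nat:
  "0 < t \<Longrightarrow> ext_Beta_kernel p \<nu> (x + of_nat m) y t = of_real t ^ m * ext_Beta_kernel p \<nu> x y t"
  by (simp add: ext_Beta_kernel_def powr_add diff_add_eq [symmetric] powr_nat')

text \<open>With \<open>s = t * (1 - t)\<close>, the powers are at most \<open>(1 / s) ^ N\<close>
  and the Bessel factor is at most a constant times \<open>exp (- p / s)\<close>, so the product is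
  bounded on an interval of finite length.\<close>

lemma set_integrable_ext_Beta_kernel:
  fixes p \<nu> :: real
  assumes "p > 0"
  shows "set_integrable lborel {0<..<1} (ext_Beta_kernel (of_real p) \<nu> x y)"
proof -
  \<comment> \<open>This is the Bessel function of order \<open>\<nu> + 1 / 2\<close> at
    \<open>p\<close>, the least value of \<open>p / s\<close>.\<close>
  let ?K = "LINT u:{0<..}|lborel. exp (- (p * cosh u)) * cosh ((\<nu> + 1 / 2) * u)"
  obtain N :: nat where N: "max \<bar>Re x - 3 / 2\<bar> \<bar>Re y - 3 / 2\<bar> \<le> real N"
    using real_arch_simple by blast
  have K: "?K \<ge> 0"
    unfolding set_lebesgue_integral_def
    by (intro Bochner_Integration.integral_nonneg) (auto simp: cosh_real_nonneg)
  have bound: "norm (ext_Beta_kernel (of_real p) \<nu> x y t) \<le> fact N / p ^ N * (exp p * ?K)"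
    if t: "0 < t" "t < 1" for t
  proof -
    define s where "s = t * (1 - t)"
    have s: "0 < s" "s \<le> 1"
      using t by (auto simp: s_def mult_le_one)
    have powr_le: "r powr e \<le> (1 / r) ^ N" if "0 < r" "r < 1" "\<bar>e\<bar> \<le> real N" for r e :: real
    proof -
      have "r powr e \<le> r powr (- real N)"
        using that by (intro powr_mono') auto
      then show ?thesis
        using that by (simp add: powr_minus powr_realpow power_divide divide_inverse power_inverse)
    qed
    have 1: "norm (complex_of_real t powr (x - 3 / 2)) \<le> (1 / t) ^ N"
      using t N powr_le[of t "Re x - 3 / 2"] by (simp add: norm_powr_real_powr)
    have 2: "norm (complex_of_real (1 - t) powr (y - 3 / 2)) \<le> (1 / (1 - t)) ^ N"
      using t N powr_le[of "1 - t" "Re y - 3 / 2"]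
      by (subst norm_powr_real_powr) (auto simp del: of_real_diff)
    have "p \<le> p / s"
      using s assms by (simp add: field_simps)
    then have 3: "norm (Bessel_K (of_real (\<nu> + 1 / 2)) (of_real p / of_real s)) \<le> exp (p - p / s) * ?K"
      using norm_Bessel_K_le[of p "p / s" "\<nu> + 1 / 2"] assms by (simp only: of_real_divide)
    have "norm (ext_Beta_kernel (of_real p) \<nu> x y t) \<le>
        (1 / t) ^ N * (1 / (1 - t)) ^ N * (exp (p - p / s) * ?K)"
      unfolding ext_Beta_kernel_def norm_mult s_def[symmetric]
      using t by (intro mult_mono 1 2 3) auto
    also have "\<dots> = ((1 / s) ^ N * exp (- (p * (1 / s)))) * (exp p * ?K)"
    proof -
      have "(1 / t) ^ N * (1 / (1 - t)) ^ N = (1 / s) ^ N"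
        by (simp add: s_def flip: power_mult_distrib)
      moreover have "exp (p - p / s) = exp (- (p * (1 / s))) * exp p"
        by (simp flip: exp_add)
      ultimately show ?thesis
        by (simp only: mult_ac)
    qed
    also have "\<dots> \<le> fact N / p ^ N * (exp p * ?K)"
      using s assms K by (intro mult_right_mono power_mult_exp_minus_le) auto
    finally show ?thesis .
  qed
  \<comment> \<open>The principal power need not be continuous at 0, so measurability is read off
    from an explicit formula by the sign of \<open>t\<close>.\<close>
  have [measurable]: "(\<lambda>t. complex_of_real t powr a) \<in> borel_measurable borel" for a
  proof -
    have "complex_of_real t powr a =
        (if t = 0 then 0 else exp (a * (of_real (ln \<bar>t\<bar>) + (if t < 0 then \<i> * pi else 0))))" for t
      using Ln_of_real[of t] Ln_of_real[of "- t"] Ln_minus[of "of_real (- t)"]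
      by (auto simp: powr_def)
    then show ?thesis
      by simp
  qed
  have [measurable]: "(\<lambda>t. complex_of_real (1 - t) powr a) \<in> borel_measurable borel" for a
    by (rule measurable_compose[of "\<lambda>t. 1 - t" borel borel]) auto
  have [measurable]: "ext_Beta_kernel (of_real p) \<nu> x y \<in> borel_measurable borel"
    unfolding ext_Beta_kernel_def by measurable
  show ?thesis
    unfolding set_integrable_def
    by (rule integrableI_bounded_set_indicator) (use bound in \<open>auto intro!: AE_I2\<close>)
qed

section \<open>Kummer's transformation for positive \<open>p\<close>\<close>

lemma ext_Beta_series_sums:
  fixes p \<nu> :: real and b y z :: complex
  assumes "p > 0"
  shows "(\<lambda>m. ext_Beta (of_real p) \<nu> (b + of_nat m) y * z ^ m / fact m) sums
    (csqrt (2 * of_real p / of_real pi) *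
     (LINT t:{0<..<1}|lborel. exp (z * of_real t) * ext_Beta_kernel (of_real p) \<nu> b y t))"
proof -
  let ?g = "\<lambda>t. indicat_real {0<..<1} t *\<^sub>R ext_Beta_kernel (of_real p) \<nu> b y t"
  let ?f = "\<lambda>m t. (z * of_real t) ^ m / fact m * ?g t"
  have g: "integrable lborel ?g"
    using set_integrable_ext_Beta_kernel[OF assms] by (simp add: set_integrable_def)
  \<comment> \<open>This one bound gives integrability of each term, pointwise absolute convergence
    and summability of the integrals of the norms, as needed to exchange sum and integral.\<close>
  have le: "norm (?f m t) \<le> norm z ^ m / fact m * norm (?g t)" for m t
  proof (cases "t \<in> {0<..<1}")
    case True
    then have "(norm z * \<bar>t\<bar>) ^ m \<le> norm z ^ m"
      by (intro power_mono) (auto intro: mult_left_le)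
    then show ?thesis
      unfolding norm_mult[of _ "?g t"]
      by (intro mult_right_mono) (auto simp: norm_mult norm_divide norm_power divide_right_mono)
  qed simp
  have f: "integrable lborel (?f m)" for m
  proof (rule Bochner_Integration.integrable_bound)
    show "integrable lborel (\<lambda>t. norm z ^ m / fact m * norm (?g t))"
      using g by (intro integrable_mult_right integrable_norm)
    show "?f m \<in> borel_measurable lborel"
      using borel_measurable_integrable[OF g] by measurable
    show "AE t in lborel. norm (?f m t) \<le> norm (norm z ^ m / fact m * norm (?g t))"
      using le by (auto intro!: AE_I2)
  qed
  have exp_sums: "(\<lambda>m. (z * of_real t) ^ m / fact m) sums exp (z * of_real t)" for t
    using exp_converges[of "z * of_real t"] by (simp add: scaleR_conv_of_real divide_inverse mult.commute)
  have sz: "summable (\<lambda>m. norm z ^ m / fact m)"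
    using summable_exp[of "norm z"] by (simp add: divide_inverse mult.commute)
  have "(\<lambda>m. integral\<^sup>L lborel (?f m)) sums (\<integral>t. (\<Sum>m. ?f m t) \<partial>lborel)"
  proof (rule sums_integral[OF f])
    show "AE t in lborel. summable (\<lambda>m. norm (?f m t))"
      using le by (intro AE_I2 summable_comparison_test'[OF summable_mult2[OF sz]]) auto
    show "summable (\<lambda>m. \<integral>t. norm (?f m t) \<partial>lborel)"
    proof (rule summable_comparison_test'[OF summable_mult2[OF sz]])
      fix m
      have "(\<integral>t. norm (?f m t) \<partial>lborel) \<le> (\<integral>t. norm z ^ m / fact m * norm (?g t) \<partial>lborel)"
        by (intro integral_mono integrable_norm[OF f] integrable_mult_right integrable_norm[OF g] le)
      then show "norm (\<integral>t. norm (?f m t) \<partial>lborel) \<le>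
          norm z ^ m / fact m * (\<integral>t. norm (?g t) \<partial>lborel)"
        by simp
    qed
  qed
  moreover have "(\<Sum>m. ?f m t) = exp (z * of_real t) * ?g t" for t
    by (rule sums_unique[symmetric]) (intro sums_mult2 exp_sums)
  \<comment> \<open>Raising the first parameter by \<open>m\<close> multiplies the kernel by
    \<open>t ^ m\<close>, which joins \<open>z ^ m / fact m\<close> to form a term of the series of
    \<open>exp (z * t)\<close>.\<close>
  moreover have "ext_Beta (of_real p) \<nu> (b + of_nat m) y * z ^ m / fact m =
      csqrt (2 * of_real p / of_real pi) * integral\<^sup>L lborel (?f m)" for m
  proof -
    have "ext_Beta (of_real p) \<nu> (b + of_nat m) y =
        csqrt (2 * of_real p / of_real pi) * (\<integral>t. of_real t ^ m * ?g t \<partial>lborel)"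
      unfolding ext_Beta_def set_lebesgue_integral_def ext_Beta_kernel_def[symmetric]
      by (intro arg_cong2[where f = "(*)"] refl Bochner_Integration.integral_cong)
        (auto simp: indicator_def ext_Beta_kernel_add_of_nat)
    moreover have "integral\<^sup>L lborel (?f m) =
        z ^ m / fact m * (\<integral>t. of_real t ^ m * ?g t \<partial>lborel)"
      unfolding integral_mult_right_zero[symmetric]
      by (intro Bochner_Integration.integral_cong) (auto simp: power_mult_distrib)
    ultimately show ?thesis
      by simp
  qed
  ultimately show ?thesis
    unfolding set_lebesgue_integral_def by (auto intro: sums_mult)
qed

text \<open>The substitution of \<open>1 - t\<close> for \<open>t\<close> swaps \<open>x\<close> and
  \<open>y\<close> in the kernel and splits \<open>exp z\<close> off the exponential.\<close>

lemma LINT_ext_Beta_kernel_reflect: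
  "(LINT t:{0<..<1}|lborel. exp (z * of_real t) * ext_Beta_kernel p \<nu> x y t) =
   exp z * (LINT t:{0<..<1}|lborel. exp (- z * of_real t) * ext_Beta_kernel p \<nu> y x t)"
proof -
  have "(LINT t:{0<..<1}|lborel. exp (z * of_real t) * ext_Beta_kernel p \<nu> x y t) =
      (\<integral>t. indicat_real {0<..<1} (1 + (- 1) * t) *\<^sub>R
        (exp (z * of_real (1 + (- 1) * t)) * ext_Beta_kernel p \<nu> x y (1 + (- 1) * t)) \<partial>lborel)"
    unfolding set_lebesgue_integral_def
    by (subst lborel_integral_real_affine[where c = "-1" and t = 1]) auto
  also have "\<dots> = (\<integral>t. exp z * (indicat_real {0<..<1} t *\<^sub>R
      (exp (- z * of_real t) * ext_Beta_kernel p \<nu> y x t)) \<partial>lborel)"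
    by (intro Bochner_Integration.integral_cong)
      (auto simp: indicator_def ext_Beta_kernel_reflect exp_diff exp_minus field_simps)
  finally show ?thesis
    unfolding set_lebesgue_integral_def by (simp only: integral_mult_right_zero)
qed

text \<open>Both series become integrals exchanged by the reflection; the normalising factors agree
  because \<open>Beta\<close> is symmetric and \<open>c - (c - b) = b\<close>.\<close>

lemma ext_confluent_hyp_Kummer_pos:
  fixes p \<nu> :: real
  assumes "p > 0"
  shows "ext_confluent_hyp (of_real p) \<nu> b c z =
    exp z * ext_confluent_hyp (of_real p) \<nu> (c - b) c (- z)"
proof -
  let ?s = "csqrt (2 * of_real p / of_real pi)"
  have "ext_confluent_hyp (of_real p) \<nu> b c z =
      ?s * (LINT t:{0<..<1}|lborel. exp (z * of_real t) *
        ext_Beta_kernel (of_real p) \<nu> b (c - b) t) / Beta b (c - b)" for b z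
    using assms sums_unique[OF sums_divide[OF ext_Beta_series_sums[OF assms, of \<nu> b "c - b" z],
      of "Beta b (c - b)"]]
    by (simp add: ext_confluent_hyp_def field_simps)
  then show ?thesis
    using LINT_ext_Beta_kernel_reflect[of z "of_real p" \<nu> b "c - b"]
    by (simp add: Beta_commute)
qed

section \<open>Kummer's transformation for \<open>p = 0\<close>\<close>

lemma summable_norm_Kummer_series:
  fixes a c z :: complex
  assumes "c \<notin> \<int>\<^sub>\<le>\<^sub>0"
  shows "summable (\<lambda>n. norm (pochhammer a n / pochhammer c n * z ^ n / fact n))"
proof -
  let ?f = "\<lambda>n. pochhammer a n / pochhammer c n * z ^ n / fact n"
  \<comment> \<open>The left side bounds the ratio of consecutive terms once \<open>n\<close>
    exceeds \<open>norm c\<close>, and it tends to 0.\<close>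
  have "eventually (\<lambda>n. (norm a + real n) / (real n - norm c) * norm z / (real n + 1) < 1 / 2)
      sequentially"
    by real_asymp
  moreover have "eventually (\<lambda>n. real n > norm c) sequentially"
    by real_asymp
  ultimately obtain N where N: "\<And>n. n \<ge> N \<Longrightarrow> real n > norm c"
      "\<And>n. n \<ge> N \<Longrightarrow> (norm a + real n) / (real n - norm c) * norm z / (real n + 1) < 1 / 2"
    by (metis (mono_tags, lifting) eventually_conj eventually_sequentially)
  have "norm (?f (Suc n)) \<le> 1 / 2 * norm (?f n)" if n: "n \<ge> N" for n
  proof -
    have "norm (a + of_nat n) \<le> norm a + real n"
      by (metis norm_of_nat norm_triangle_ineq)
    moreover have "real n - norm c \<le> norm (c + of_nat n)"
      by (metis add.commute norm_diff_ineq norm_of_nat)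
    ultimately have "norm (a + of_nat n) / norm (c + of_nat n) * norm z / (real n + 1) \<le>
        (norm a + real n) / (real n - norm c) * norm z / (real n + 1)"
      using N(1)[OF n] by (intro divide_right_mono mult_right_mono frac_le) auto
    also have "\<dots> \<le> 1 / 2"
      using N(2)[OF n] by simp
    finally have le: "norm (a + of_nat n) / norm (c + of_nat n) * norm z / (real n + 1) \<le> 1 / 2" .
    have eq: "norm (?f (Suc n)) =
        norm (a + of_nat n) / norm (c + of_nat n) * norm z / (real n + 1) * norm (?f n)"
    proof -
      have "norm (1 + of_nat n :: complex) = 1 + real n"
        using norm_of_nat[of "Suc n", where 'a = complex] by simp
      then show ?thesis
        by (simp add: pochhammer_Suc norm_mult norm_divide norm_power add.commute)
          (simp only: divide_inverse inverse_mult_distrib mult_ac)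
    qed
    show ?thesis
      unfolding eq by (rule mult_right_mono[OF le norm_ge_zero])
  qed
  then have "norm (norm (?f (Suc n))) \<le> 1 / 2 * norm (norm (?f n))" if "n \<ge> N" for n
    using that by simp
  then show ?thesis
    by (rule summable_ratio_test[of "1 / 2", rotated]) auto
qed

text \<open>Away from the poles the \<open>Gamma\<close> quotients are rising factorials, the form
  suited to the ratio test and to Chu--Vandermonde.\<close>

lemma confluent_hyp_eq_pochhammer:
  assumes "b \<notin> \<int>\<^sub>\<le>\<^sub>0" and "c \<notin> \<int>\<^sub>\<le>\<^sub>0"
  shows "confluent_hyp b c z = (\<Sum>n. pochhammer b n / pochhammer c n * z ^ n / fact n)"
  unfolding confluent_hyp_def
  using assms by (simp add: pochhammer_Gamma)

lemma confluent_hyp_Kummer: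
  assumes b: "b \<notin> \<int>\<^sub>\<le>\<^sub>0" and cb: "c - b \<notin> \<int>\<^sub>\<le>\<^sub>0" and c: "c \<notin> \<int>\<^sub>\<le>\<^sub>0"
  shows "confluent_hyp b c z = exp z * confluent_hyp (c - b) c (- z)"
proof -
  let ?f = "\<lambda>n. pochhammer (c - b) n / pochhammer c n * (- z) ^ n / fact n"
  let ?e = "\<lambda>n. z ^ n / fact n"
  have e: "?e sums exp z"
    using exp_converges[of z] by (simp add: scaleR_conv_of_real divide_inverse mult.commute)
  have "summable (\<lambda>n. norm (?e n))"
    using summable_norm_exp[of z] by (simp add: scaleR_conv_of_real divide_inverse mult.commute)
  then have "(\<lambda>n. \<Sum>k\<le>n. ?f k * ?e (n - k)) sums ((\<Sum>n. ?f n) * (\<Sum>n. ?e n))"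
    by (rule Cauchy_product_sums[OF summable_norm_Kummer_series[OF c]])
  moreover have "(\<Sum>k\<le>n. ?f k * ?e (n - k)) = pochhammer b n / pochhammer c n * z ^ n / fact n" for n
  proof -
    have "?f k * ?e (n - k) = z ^ n / fact n *
        (pochhammer (c - b) k * pochhammer (- of_nat n) k / (of_nat (fact k) * pochhammer c k))"
      if "k \<le> n" for k
    proof -
      \<comment> \<open>Both sides are the binomial coefficient of \<open>n\<close> over
        \<open>k\<close>. This trades \<open>1 / fact (n - k)\<close> for a rising factorial of
        \<open>- n\<close>, whose sign cancels that of \<open>(- z) ^ k\<close>.\<close>
      have "(- 1) ^ k * pochhammer (- of_nat n :: complex) k / fact k =
          fact n / (fact k * fact (n - k))"
        using that gbinomial_pochhammer[of "of_nat n :: complex" k]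
        by (simp only: binomial_gbinomial[symmetric] binomial_fact)
      then have "(- 1) ^ k * pochhammer (- of_nat n :: complex) k = fact n / fact (n - k)"
        by (simp add: field_simps)
      then have "pochhammer (- of_nat n :: complex) k = (- 1) ^ k * (fact n / fact (n - k))"
        by (metis left_minus_one_mult_self)
      moreover have "(- z) ^ k * z ^ (n - k) = (- 1) ^ k * z ^ n"
        using that by (simp add: power_minus[of z] flip: power_add)
      moreover have "?f k * ?e (n - k) = ((- z) ^ k * z ^ (n - k)) *
          (pochhammer (c - b) k / pochhammer c k) / (fact k * fact (n - k))"
        by (simp add: mult.assoc)
      ultimately show ?thesis
        by (simp add: mult_ac)
    qed
    then have "(\<Sum>k\<le>n. ?f k * ?e (n - k)) = z ^ n / fact n * (\<Sum>k = 0..n.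
        pochhammer (c - b) k * pochhammer (- of_nat n) k / (of_nat (fact k) * pochhammer c k))"
      unfolding sum_distrib_left by (intro sum.cong) auto
    \<comment> \<open>Chu--Vandermonde puts \<open>c - (c - b) = b\<close> into the numerator;
      \<open>c\<close> avoids the nonpositive integers, so no denominator vanishes.\<close>
    also have "\<dots> = z ^ n / fact n * (pochhammer b n / pochhammer c n)"
      using c by (subst Vandermonde_pochhammer) auto
    finally show ?thesis
      by (simp add: mult_ac)
  qed
  ultimately show ?thesis
    using sums_unique[OF e] assms by (simp add: confluent_hyp_eq_pochhammer sums_iff mult.commute)
qed

section \<open>From Kummer's transformation to the Whittaker function\<close>

theorem theorem2:
  fixes p \<nu> :: real and z \<kappa> \<mu> :: complex
  assumes "p \<ge> 0" and "\<nu> \<ge> 0" and "p = 0 \<Longrightarrow> \<nu> = 0"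
    and "z \<noteq> 0"
    and "\<And>n::nat. n \<ge> 1 \<Longrightarrow> 2 * \<mu> \<noteq> - of_nat n"
    and "\<mu> + \<kappa> + 1 / 2 \<notin> \<int>\<^sub>\<le>\<^sub>0" and "\<mu> - \<kappa> + 1 / 2 \<notin> \<int>\<^sub>\<le>\<^sub>0"
  shows "z powr (- \<mu> - 1 / 2) * ext_Whittaker_M (of_real p) \<nu> \<kappa> \<mu> z =
         (- z) powr (- \<mu> - 1 / 2) * ext_Whittaker_M (of_real p) \<nu> (- \<kappa>) \<mu> (- z)"
proof -
  define b c where "b = \<mu> - \<kappa> + 1 / 2" and "c = 2 * \<mu> + 1"
  have cb: "c - b = \<mu> + \<kappa> + 1 / 2"
    by (simp add: b_def c_def)
  have c: "c \<notin> \<int>\<^sub>\<le>\<^sub>0"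
  proof
    assume "c \<in> \<int>\<^sub>\<le>\<^sub>0"
    then obtain n where "c = - of_nat n"
      by (auto elim!: nonpos_Ints_cases')
    moreover have "2 * \<mu> = c - 1"
      by (simp add: c_def)
    \<comment> \<open>The shift by 1 in \<open>c\<close> is why the hypothesis on
      \<open>2 * \<mu>\<close> starts at \<open>n = 1\<close>.\<close>
    ultimately have "2 * \<mu> = - of_nat (Suc n)"
      by simp
    then show False
      using assms(5)[of "Suc n"] by simp
  qed
  have Kummer: "ext_confluent_hyp (of_real p) \<nu> b c z =
      exp z * ext_confluent_hyp (of_real p) \<nu> (c - b) c (- z)"
  proof (cases "p = 0")
    case True
    moreover have "b \<notin> \<int>\<^sub>\<le>\<^sub>0" "c - b \<notin> \<int>\<^sub>\<le>\<^sub>0"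
      unfolding cb using assms by (simp_all add: b_def)
    ultimately show ?thesis
      using assms(3) c confluent_hyp_Kummer[of b c z]
      by (simp add: ext_confluent_hyp_def)
  next
    case False
    then show ?thesis
      using assms by (intro ext_confluent_hyp_Kummer_pos) auto
  qed
  have cancel: "w powr (- \<mu> - 1 / 2) * (w powr (\<mu> + 1 / 2) * v) = v" if "w \<noteq> 0" for w v :: complex
  proof -
    have "w powr (- \<mu> - 1 / 2) * w powr (\<mu> + 1 / 2) = 1"
      using that by (simp flip: powr_add)
    then show ?thesis
      by (simp flip: mult.assoc)
  qed
  \<comment> \<open>The right side is the exponential prefactor of the Whittaker function at
    \<open>- z\<close>.\<close>
  have "exp (- z / 2) * exp z = exp (z / 2)"
    by (simp flip: exp_add)
  then have "exp (- z / 2) * ext_confluent_hyp (of_real p) \<nu> b c z =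
      exp (z / 2) * ext_confluent_hyp (of_real p) \<nu> (c - b) c (- z)"
    by (simp add: Kummer flip: mult.assoc)
  then show ?thesis
    using assms(4) unfolding ext_Whittaker_M_def
    by (simp add: mult.assoc cancel b_def[symmetric] c_def[symmetric] cb)
qed

end
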